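(* Let $E$ be a Dedekind complete Riesz space with universal completion $E^u$. For each $n\in\mathbb N$, $n\ge1$, let $(x_\alpha(n))_{\alpha\in\Gamma}$ be a net in $E$ (with the same directed set $\Gamma$ for all $n$). Assume that: (i) $x_\alpha(n)\overset{o}{\longrightarrow}x(n)$ for each $n$; (ii) $|x_\alpha(n)|\le y(n)$ for every $\alpha$ and every $n$, where $(y(n))$ is a sequence of positive elements of $E^u$ with $\sum_{n=1}^\infty y(n)\in E^u$. Then $$\lim_\alpha\sum_{n=1}^\infty x_\alpha(n)=\sum_{n=1}^\infty\lim_\alpha x_\alpha(n).$$
   Context: $\overset{o}{\longrightarrow}$ denotes order convergence, and all limits and sums of series are taken in order: $\sum_{n=1}^\infty x_n$ is the order limit of the partial sums $\sum_{k=1}^n x_k$. The series and the limit over $\alpha$ in the conclusion are taken in $E^u$, the universal completion of $E$. The condition $\sum y(n)\in E^u$ means that the increasing partial sums are order bounded in $E^u$. *)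

theory Defs
  imports Complex_Main "HOL-Library.Lattice_Algebras"
begin

class riesz_space = ordered_real_vector + lattice_ab_group_add_abs

class dedekind_complete_riesz_space = riesz_space + conditionally_complete_lattice

text \<open>The empty family is excluded because the least upper bounds are taken in the whole space,
  where the empty set has none unless the space is trivial.\<close>

class universally_complete_riesz_space = dedekind_complete_riesz_space +
  assumes laterally_complete:
    "A \<noteq> {} \<Longrightarrow> (\<And>a. a \<in> A \<Longrightarrow> 0 \<le> a) \<Longrightarrow>
      (\<And>a b. a \<in> A \<Longrightarrow> b \<in> A \<Longrightarrow> a \<noteq> b \<Longrightarrow> inf a b = 0) \<Longrightarrow>
      \<exists>s. (\<forall>a\<in>A. a \<le> s) \<and> (\<forall>b. (\<forall>a\<in>A. a \<le> b) \<longrightarrow> s \<le> b)"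

text \<open>The universal completion is determined up to Riesz isomorphism, so it is given by an
  embedding \<^term>\<open>j\<close> of the space onto an order dense Riesz subspace of a universally
  complete Riesz space. Preservation of infima follows from linearity and preservation of
  suprema.\<close>

definition universal_completion ::
    "('e::riesz_space \<Rightarrow> 'u::universally_complete_riesz_space) \<Rightarrow> bool" where
  "universal_completion j \<longleftrightarrow>
     linear j \<and> inj j \<and> (\<forall>a b. j (sup a b) = sup (j a) (j b)) \<and>
     (\<forall>u>0. \<exists>e. 0 < j e \<and> j e \<le> u)"

definition directed_set :: "'i set \<Rightarrow> ('i \<Rightarrow> 'i \<Rightarrow> bool) \<Rightarrow> bool" where
  "directed_set \<Gamma> le \<longleftrightarrow>
     \<Gamma> \<noteq> {} \<and> (\<forall>a\<in>\<Gamma>. le a a) \<and>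
     (\<forall>a\<in>\<Gamma>. \<forall>b\<in>\<Gamma>. \<forall>c\<in>\<Gamma>. le a b \<longrightarrow> le b c \<longrightarrow> le a c) \<and>
     (\<forall>a\<in>\<Gamma>. \<forall>b\<in>\<Gamma>. \<exists>c\<in>\<Gamma>. le a c \<and> le b c)"

text \<open>Order convergence: there is a net decreasing to zero, possibly over another index set,
  each of whose members eventually dominates the distance to the limit. Only the range of the
  dominating net matters, so it is given as a downward directed set \<open>D\<close> with infimum
  zero, indexed by itself under the reversed order.\<close>

definition order_converges ::
    "'i set \<Rightarrow> ('i \<Rightarrow> 'i \<Rightarrow> bool) \<Rightarrow> ('i \<Rightarrow> 'a::riesz_space) \<Rightarrow> 'a \<Rightarrow> bool" where
  "order_converges \<Gamma> le x l \<longleftrightarrow>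
     (\<exists>D. D \<noteq> {} \<and> (\<forall>p\<in>D. \<forall>q\<in>D. \<exists>r\<in>D. r \<le> p \<and> r \<le> q) \<and>
        (\<forall>d\<in>D. 0 \<le> d) \<and> (\<forall>b. (\<forall>d\<in>D. b \<le> d) \<longrightarrow> b \<le> 0) \<and>
        (\<forall>d\<in>D. \<exists>\<alpha>0\<in>\<Gamma>. \<forall>\<alpha>\<in>\<Gamma>. le \<alpha>0 \<alpha> \<longrightarrow> \<bar>x \<alpha> - l\<bar> \<le> d))"

text \<open>Series start at index 1; the value of a sequence at 0 is irrelevant.\<close>

definition order_sums :: "(nat \<Rightarrow> 'a::riesz_space) \<Rightarrow> 'a \<Rightarrow> bool" where
  "order_sums f s \<longleftrightarrow> order_converges UNIV (\<le>) (\<lambda>n. \<Sum>k=1..n. f k) s"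

definition order_summable :: "(nat \<Rightarrow> 'a::riesz_space) \<Rightarrow> bool" where
  "order_summable f \<longleftrightarrow> (\<exists>s. order_sums f s)"

definition order_suminf :: "(nat \<Rightarrow> 'a::riesz_space) \<Rightarrow> 'a" where
  "order_suminf f = (THE s. order_sums f s)"

end

theory Submission imports Defs begin

text \<open>The statement is dominated convergence for series. Bounding tails reduces it to finite
  sums. With \<open>T N\<close> denoting the remainder of \<open>\<Sum>y\<close> after \<open>N\<close> terms, every series \<open>f\<close> with
  \<open>\<bar>f n\<bar> \<le> y n\<close> converges and differs from its \<open>N\<close>-th partial sum by at most \<open>T N\<close>, a bound
  that does not depend on \<open>f\<close> (\<open>dominated_series\<close>). Hence the partial sums of all the
  series indexed by \<open>\<alpha>\<close>, and of the series of limits, approximate their values uniformly. Finite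
  sums commute with order limits (\<open>order_converges_sum\<close>), and since \<open>T\<close> has infimum zero, the
  limit over \<open>\<alpha>\<close> passes through the uniform approximation (\<open>order_converges_uniform_limit\<close>).

  All of this takes place in the universal completion. The hypothesis on limits lives in the
  smaller space, and is transported by \<open>order_converges_embedding\<close>: order density of the image
  keeps infima that are zero equal to zero.\<close>

section \<open>Order limits of nets\<close>

lemma directed_set_nonempty_refl:
  assumes "directed_set \<Gamma> le"
  shows "\<Gamma> \<noteq> {}" and "\<And>a. a \<in> \<Gamma> \<Longrightarrow> le a a"
  using assms unfolding directed_set_def by blast+

lemma directed_set_upper:
  assumes "directed_set \<Gamma> le" "a \<in> \<Gamma>" "b \<in> \<Gamma>"
  obtains c where "c \<in> \<Gamma>" and "\<And>\<alpha>. \<alpha> \<in> \<Gamma> \<Longrightarrow> le c \<alpha> \<Longrightarrow> le a \<alpha> \<and> le b \<alpha>"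
proof -
  note directed = assms(1)[unfolded directed_set_def, THEN conjunct2, THEN conjunct2]
  note trans = directed[THEN conjunct1] and upper = directed[THEN conjunct2]
  obtain c where c: "c \<in> \<Gamma>" "le a c" "le b c"
    using upper assms(2,3) by blast
  have "le a \<alpha> \<and> le b \<alpha>" if "\<alpha> \<in> \<Gamma>" "le c \<alpha>" for \<alpha>
    using trans[rule_format, OF assms(2) c(1) that(1) c(2) that(2)]
      trans[rule_format, OF assms(3) c(1) that(1) c(3) that(2)] by simp
  with c(1) show thesis by (rule that)
qed

lemma directed_set_nat: "directed_set (UNIV :: nat set) (\<le>)"
  unfolding directed_set_def by (auto intro: max.cobounded1 max.cobounded2)

text \<open>Over a directed index set the eventual bounds of a net are closed under binary infima, so
  they can always serve as the dominating family. This removes the duty to exhibit a family that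
  is itself downward directed: any collection \<open>D\<close> of eventual bounds with infimum zero will do.\<close>

lemma order_convergesI:
  fixes x :: "'i \<Rightarrow> 'a::riesz_space"
  assumes \<Gamma>: "directed_set \<Gamma> le"
    and ne: "D \<noteq> {}"
    and inf0: "\<And>b. (\<And>d. d \<in> D \<Longrightarrow> b \<le> d) \<Longrightarrow> b \<le> 0"
    and ev: "\<And>d. d \<in> D \<Longrightarrow> \<exists>\<alpha>0\<in>\<Gamma>. \<forall>\<alpha>\<in>\<Gamma>. le \<alpha>0 \<alpha> \<longrightarrow> \<bar>x \<alpha> - l\<bar> \<le> d"
  shows "order_converges \<Gamma> le x l"
proof -
  define B where "B = {d. \<exists>\<alpha>0\<in>\<Gamma>. \<forall>\<alpha>\<in>\<Gamma>. le \<alpha>0 \<alpha> \<longrightarrow> \<bar>x \<alpha> - l\<bar> \<le> d}"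
  have DB: "D \<subseteq> B" using ev by (auto simp: B_def)
  have "\<exists>r\<in>B. r \<le> p \<and> r \<le> q" if "p \<in> B" "q \<in> B" for p q
  proof -
    obtain a where a: "a \<in> \<Gamma>" "\<And>\<alpha>. \<alpha> \<in> \<Gamma> \<Longrightarrow> le a \<alpha> \<Longrightarrow> \<bar>x \<alpha> - l\<bar> \<le> p"
      using \<open>p \<in> B\<close> by (auto simp: B_def)
    obtain b where b: "b \<in> \<Gamma>" "\<And>\<alpha>. \<alpha> \<in> \<Gamma> \<Longrightarrow> le b \<alpha> \<Longrightarrow> \<bar>x \<alpha> - l\<bar> \<le> q"
      using \<open>q \<in> B\<close> by (auto simp: B_def)
    obtain c where c: "c \<in> \<Gamma>" "\<And>\<alpha>. \<alpha> \<in> \<Gamma> \<Longrightarrow> le c \<alpha> \<Longrightarrow> le a \<alpha> \<and> le b \<alpha>"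
      using directed_set_upper[OF \<Gamma> a(1) b(1)] by metis
    have "\<bar>x \<alpha> - l\<bar> \<le> inf p q" if "\<alpha> \<in> \<Gamma>" "le c \<alpha>" for \<alpha>
      using a(2) b(2) c(2) that by simp
    then have "inf p q \<in> B" using c(1) by (auto simp: B_def)
    then show ?thesis by (meson inf.cobounded1 inf.cobounded2)
  qed
  moreover have "0 \<le> d" if "d \<in> B" for d
  proof -
    obtain a where "a \<in> \<Gamma>" "\<bar>x a - l\<bar> \<le> d"
      using \<open>d \<in> B\<close> directed_set_nonempty_refl(2)[OF \<Gamma>] unfolding B_def by blast
    then show ?thesis by (meson abs_ge_zero order_trans)
  qed
  moreover have "b \<le> 0" if "\<forall>d\<in>B. b \<le> d" for b
    using that DB by (intro inf0) blast
  moreover have "B \<noteq> {}" using ne DB by blast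
  ultimately show ?thesis
    unfolding order_converges_def by (intro exI[of _ B]) (simp add: B_def)
qed

lemma order_convergesE:
  fixes x :: "'i \<Rightarrow> 'a::riesz_space"
  assumes "order_converges \<Gamma> le x l"
  obtains D where "D \<noteq> {}"
    and "\<And>d. d \<in> D \<Longrightarrow> 0 \<le> d"
    and "\<And>b. (\<And>d. d \<in> D \<Longrightarrow> b \<le> d) \<Longrightarrow> b \<le> 0"
    and "\<And>d. d \<in> D \<Longrightarrow> \<exists>\<alpha>0\<in>\<Gamma>. \<forall>\<alpha>\<in>\<Gamma>. le \<alpha>0 \<alpha> \<longrightarrow> \<bar>x \<alpha> - l\<bar> \<le> d"
proof -
  obtain D where D: "D \<noteq> {}" "\<forall>d\<in>D. 0 \<le> d" "\<forall>b. (\<forall>d\<in>D. b \<le> d) \<longrightarrow> b \<le> 0"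
      "\<forall>d\<in>D. \<exists>\<alpha>0\<in>\<Gamma>. \<forall>\<alpha>\<in>\<Gamma>. le \<alpha>0 \<alpha> \<longrightarrow> \<bar>x \<alpha> - l\<bar> \<le> d"
    using assms unfolding order_converges_def by (elim exE conjE)
  show thesis by (rule that[of D]) (use D in auto)
qed

lemma order_converges_const:
  fixes l :: "'a::riesz_space"
  assumes "directed_set \<Gamma> le"
  shows "order_converges \<Gamma> le (\<lambda>\<alpha>. l) l"
proof (rule order_convergesI[OF assms, where D = "{0}"])
  show "b \<le> 0" if "\<And>d. d \<in> {0} \<Longrightarrow> b \<le> d" for b :: 'a
    by (rule that) simp
  show "\<exists>\<alpha>0\<in>\<Gamma>. \<forall>\<alpha>\<in>\<Gamma>. le \<alpha>0 \<alpha> \<longrightarrow> \<bar>l - l\<bar> \<le> d" if "d \<in> {0}" for d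
    using directed_set_nonempty_refl(1)[OF assms] that by auto
qed simp

lemma order_converges_add:
  fixes x y :: "'i \<Rightarrow> 'a::riesz_space"
  assumes \<Gamma>: "directed_set \<Gamma> le"
    and x: "order_converges \<Gamma> le x l" and y: "order_converges \<Gamma> le y m"
  shows "order_converges \<Gamma> le (\<lambda>\<alpha>. x \<alpha> + y \<alpha>) (l + m)"
proof -
  obtain D where D: "D \<noteq> {}" "\<And>b. (\<And>d. d \<in> D \<Longrightarrow> b \<le> d) \<Longrightarrow> b \<le> 0"
      "\<And>d. d \<in> D \<Longrightarrow> \<exists>\<alpha>0\<in>\<Gamma>. \<forall>\<alpha>\<in>\<Gamma>. le \<alpha>0 \<alpha> \<longrightarrow> \<bar>x \<alpha> - l\<bar> \<le> d"
    using order_convergesE[OF x] by metis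
  obtain C where C: "C \<noteq> {}" "\<And>b. (\<And>c. c \<in> C \<Longrightarrow> b \<le> c) \<Longrightarrow> b \<le> 0"
      "\<And>c. c \<in> C \<Longrightarrow> \<exists>\<alpha>0\<in>\<Gamma>. \<forall>\<alpha>\<in>\<Gamma>. le \<alpha>0 \<alpha> \<longrightarrow> \<bar>y \<alpha> - m\<bar> \<le> c"
    using order_convergesE[OF y] by metis
  show ?thesis
  proof (rule order_convergesI[OF \<Gamma>, where D = "(\<lambda>(d, c). d + c) ` (D \<times> C)"])
    show "(\<lambda>(d, c). d + c) ` (D \<times> C) \<noteq> {}" using C(1) D(1) by auto
  next
    fix b assume b: "\<And>e. e \<in> (\<lambda>(d, c). d + c) ` (D \<times> C) \<Longrightarrow> b \<le> e"
    have "b - c \<le> 0" if "c \<in> C" for c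
    proof (rule D(2))
      fix d assume "d \<in> D"
      then have "b \<le> d + c" using that by (intro b) auto
      then show "b - c \<le> d" by (simp add: diff_le_eq)
    qed
    then show "b \<le> 0" by (intro C(2)) simp
  next
    fix e assume "e \<in> (\<lambda>(d, c). d + c) ` (D \<times> C)"
    then obtain d c where e: "e = d + c" "d \<in> D" "c \<in> C" by auto
    obtain p where p: "p \<in> \<Gamma>" "\<And>\<alpha>. \<alpha> \<in> \<Gamma> \<Longrightarrow> le p \<alpha> \<Longrightarrow> \<bar>x \<alpha> - l\<bar> \<le> d"
      using D(3)[OF e(2)] by blast
    obtain q where q: "q \<in> \<Gamma>" "\<And>\<alpha>. \<alpha> \<in> \<Gamma> \<Longrightarrow> le q \<alpha> \<Longrightarrow> \<bar>y \<alpha> - m\<bar> \<le> c"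
      using C(3)[OF e(3)] by blast
    obtain r where r: "r \<in> \<Gamma>" "\<And>\<alpha>. \<alpha> \<in> \<Gamma> \<Longrightarrow> le r \<alpha> \<Longrightarrow> le p \<alpha> \<and> le q \<alpha>"
      using directed_set_upper[OF \<Gamma> p(1) q(1)] by metis
    have "\<bar>x \<alpha> + y \<alpha> - (l + m)\<bar> \<le> e" if "\<alpha> \<in> \<Gamma>" "le r \<alpha>" for \<alpha>
    proof -
      have "\<bar>x \<alpha> + y \<alpha> - (l + m)\<bar> \<le> \<bar>x \<alpha> - l\<bar> + \<bar>y \<alpha> - m\<bar>"
        using abs_triangle_ineq[of "x \<alpha> - l" "y \<alpha> - m"] by (simp add: add_diff_add)
      also have "\<dots> \<le> e"
        unfolding e(1) using p(2) q(2) r(2) that by (intro add_mono) auto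
      finally show ?thesis .
    qed
    then show "\<exists>\<alpha>0\<in>\<Gamma>. \<forall>\<alpha>\<in>\<Gamma>. le \<alpha>0 \<alpha> \<longrightarrow> \<bar>x \<alpha> + y \<alpha> - (l + m)\<bar> \<le> e"
      using r(1) by blast
  qed
qed

lemma order_converges_sum:
  fixes x :: "'i \<Rightarrow> 'k \<Rightarrow> 'a::riesz_space"
  assumes "directed_set \<Gamma> le" "finite K"
    and "\<And>k. k \<in> K \<Longrightarrow> order_converges \<Gamma> le (\<lambda>\<alpha>. x \<alpha> k) (l k)"
  shows "order_converges \<Gamma> le (\<lambda>\<alpha>. \<Sum>k\<in>K. x \<alpha> k) (\<Sum>k\<in>K. l k)"
  using assms(2,3)
proof (induction K rule: finite_induct)
  case empty
  show ?case using order_converges_const[OF assms(1), where l = "0::'a"] by simp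
next
  case (insert k K)
  then have "order_converges \<Gamma> le (\<lambda>\<alpha>. x \<alpha> k + (\<Sum>k\<in>K. x \<alpha> k)) (l k + (\<Sum>k\<in>K. l k))"
    by (intro order_converges_add[OF assms(1)]) simp_all
  then show ?case using insert.hyps by simp
qed

text \<open>Symmetric order intervals are order closed: the slack in \<open>\<bar>l\<bar> \<le> \<bar>x \<alpha> - l\<bar> + \<bar>x \<alpha>\<bar>\<close> has infimum
  zero.\<close>

lemma order_converges_abs_le:
  fixes x :: "'i \<Rightarrow> 'a::riesz_space"
  assumes \<Gamma>: "directed_set \<Gamma> le" and x: "order_converges \<Gamma> le x l"
    and bound: "\<And>\<alpha>. \<alpha> \<in> \<Gamma> \<Longrightarrow> \<bar>x \<alpha>\<bar> \<le> u"
  shows "\<bar>l\<bar> \<le> u"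
proof -
  obtain D where D: "\<And>b. (\<And>d. d \<in> D \<Longrightarrow> b \<le> d) \<Longrightarrow> b \<le> 0"
      "\<And>d. d \<in> D \<Longrightarrow> \<exists>\<alpha>0\<in>\<Gamma>. \<forall>\<alpha>\<in>\<Gamma>. le \<alpha>0 \<alpha> \<longrightarrow> \<bar>x \<alpha> - l\<bar> \<le> d"
    using order_convergesE[OF x] by metis
  have "\<bar>l\<bar> - u \<le> 0"
  proof (rule D(1))
    fix d assume "d \<in> D"
    then obtain a where a: "a \<in> \<Gamma>" "\<bar>x a - l\<bar> \<le> d"
      using D(2) directed_set_nonempty_refl(2)[OF \<Gamma>] by blast
    have "\<bar>l\<bar> \<le> \<bar>x a - l\<bar> + \<bar>x a\<bar>"
      using abs_triangle_ineq[of "l - x a" "x a"] by (simp add: abs_minus_commute)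
    also have "\<dots> \<le> d + u" using a bound by (intro add_mono) auto
    finally show "\<bar>l\<bar> - u \<le> d" by (simp add: diff_le_eq)
  qed
  then show ?thesis by simp
qed

lemma order_converges_unique:
  fixes x :: "'i \<Rightarrow> 'a::riesz_space"
  assumes \<Gamma>: "directed_set \<Gamma> le"
    and l: "order_converges \<Gamma> le x l" and m: "order_converges \<Gamma> le x m"
  shows "l = m"
proof -
  have "order_converges \<Gamma> le (\<lambda>\<alpha>. - x \<alpha>) (- m)"
    using m by (simp add: order_converges_def abs_minus_commute)
  then have "order_converges \<Gamma> le (\<lambda>\<alpha>. x \<alpha> + - x \<alpha>) (l + - m)"
    by (rule order_converges_add[OF \<Gamma> l])
  then have "\<bar>l + - m\<bar> \<le> 0"
    by (rule order_converges_abs_le[OF \<Gamma>]) simp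
  then show ?thesis by simp
qed

text \<open>The Moore--Osgood interchange. An error \<open>t n\<close> occurs twice, once for the net and once for
  its limit, so a lower bound \<open>b\<close> of the resulting eventual bounds satisfies \<open>b \<le> 2 t n\<close>;
  halving \<open>b\<close> uses up this factor.\<close>

lemma order_converges_uniform_limit:
  fixes f :: "'i \<Rightarrow> 'a::riesz_space" and F :: "'n \<Rightarrow> 'i \<Rightarrow> 'a"
  assumes \<Gamma>: "directed_set \<Gamma> le"
    and conv: "\<And>n. order_converges \<Gamma> le (F n) (G n)"
    and f: "\<And>n \<alpha>. \<alpha> \<in> \<Gamma> \<Longrightarrow> \<bar>F n \<alpha> - f \<alpha>\<bar> \<le> t n"
    and g: "\<And>n. \<bar>G n - g\<bar> \<le> t n"
    and t: "\<And>b. (\<And>n. b \<le> t n) \<Longrightarrow> b \<le> 0"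
  shows "order_converges \<Gamma> le f g"
proof -
  have "\<exists>D. D \<noteq> {} \<and> (\<forall>b. (\<forall>d\<in>D. b \<le> d) \<longrightarrow> b \<le> 0) \<and>
      (\<forall>d\<in>D. \<exists>\<alpha>0\<in>\<Gamma>. \<forall>\<alpha>\<in>\<Gamma>. le \<alpha>0 \<alpha> \<longrightarrow> \<bar>F n \<alpha> - G n\<bar> \<le> d)" for n
    using order_convergesE[OF conv[of n]] by metis
  then obtain D where D: "\<And>n. D n \<noteq> {}"
      "\<And>n b. (\<And>d. d \<in> D n \<Longrightarrow> b \<le> d) \<Longrightarrow> b \<le> 0"
      "\<And>n d. d \<in> D n \<Longrightarrow> \<exists>\<alpha>0\<in>\<Gamma>. \<forall>\<alpha>\<in>\<Gamma>. le \<alpha>0 \<alpha> \<longrightarrow> \<bar>F n \<alpha> - G n\<bar> \<le> d"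
    by metis
  define B where "B = (\<Union>n. (\<lambda>d. d + (t n + t n)) ` D n)"
  show ?thesis
  proof (rule order_convergesI[OF \<Gamma>, where D = B])
    show "B \<noteq> {}" using D(1) by (auto simp: B_def)
  next
    fix b assume b: "\<And>e. e \<in> B \<Longrightarrow> b \<le> e"
    have "(1/2) *\<^sub>R b \<le> t n" for n
    proof -
      have "b - (t n + t n) \<le> 0"
      proof (rule D(2))
        fix d assume "d \<in> D n"
        then have "b \<le> d + (t n + t n)" by (intro b) (auto simp: B_def)
        then show "b - (t n + t n) \<le> d" by (simp add: diff_le_eq)
      qed
      then have "(1/2) *\<^sub>R b \<le> (1/2) *\<^sub>R (t n + t n)"
        by (intro scaleR_left_mono) auto
      then show ?thesis by simp
    qed
    then have "(1/2) *\<^sub>R b \<le> 0" by (rule t)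
    then have "2 *\<^sub>R ((1/2) *\<^sub>R b) \<le> 2 *\<^sub>R (0::'a)" by (rule scaleR_left_mono) simp
    then show "b \<le> 0" by simp
  next
    fix e assume "e \<in> B"
    then obtain n d where e: "d \<in> D n" "e = d + (t n + t n)" by (auto simp: B_def)
    obtain p where p: "p \<in> \<Gamma>" "\<And>\<alpha>. \<alpha> \<in> \<Gamma> \<Longrightarrow> le p \<alpha> \<Longrightarrow> \<bar>F n \<alpha> - G n\<bar> \<le> d"
      using D(3)[OF e(1)] by blast
    have "\<bar>f \<alpha> - g\<bar> \<le> e" if "\<alpha> \<in> \<Gamma>" "le p \<alpha>" for \<alpha>
    proof -
      have "\<bar>f \<alpha> - g\<bar> = \<bar>(F n \<alpha> - G n) + ((f \<alpha> - F n \<alpha>) + (G n - g))\<bar>"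
        by (simp add: algebra_simps)
      also have "\<dots> \<le> \<bar>F n \<alpha> - G n\<bar> + (\<bar>f \<alpha> - F n \<alpha>\<bar> + \<bar>G n - g\<bar>)"
        by (meson abs_triangle_ineq add_left_mono order_trans)
      also have "\<dots> \<le> d + (t n + t n)"
        using p(2)[OF that] f[OF that(1), of n] g[of n]
        by (intro add_mono) (auto simp: abs_minus_commute)
      finally show ?thesis by (simp add: e(2))
    qed
    then show "\<exists>\<alpha>0\<in>\<Gamma>. \<forall>\<alpha>\<in>\<Gamma>. le \<alpha>0 \<alpha> \<longrightarrow> \<bar>f \<alpha> - g\<bar> \<le> e" using p(1) by blast
  qed
qed

section \<open>Transport to the universal completion\<close>

text \<open>Only the infimum of the dominating family needs an argument. If the image of \<open>D\<close> had a lower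
  bound \<open>b\<close> not below zero, the positive part of \<open>b\<close> would dominate some \<open>j e\<close> with \<open>j e > 0\<close>;
  as the image of \<open>D\<close> is positive, that positive part is again a lower bound of it, and since
  \<open>j\<close> reflects the order, \<open>e\<close> would be a lower bound of \<open>D\<close>, although \<open>D\<close> has infimum zero.\<close>

lemma order_converges_embedding:
  fixes j :: "'e::riesz_space \<Rightarrow> 'u::universally_complete_riesz_space"
  assumes j: "universal_completion j" and \<Gamma>: "directed_set \<Gamma> le"
    and x: "order_converges \<Gamma> le x l"
  shows "order_converges \<Gamma> le (\<lambda>\<alpha>. j (x \<alpha>)) (j l)"
proof -
  have lin: "linear j" and "inj j" and sup: "\<And>a b. j (sup a b) = sup (j a) (j b)"
    and dense: "\<And>u. 0 < u \<Longrightarrow> \<exists>e. 0 < j e \<and> j e \<le> u"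
    using j unfolding universal_completion_def by auto
  have le_iff: "j a \<le> j b \<longleftrightarrow> a \<le> b" for a b
    using \<open>inj j\<close> by (metis sup inj_eq le_iff_sup)
  have abs: "\<bar>j a - j b\<bar> = j \<bar>a - b\<bar>" for a b
    by (simp add: abs_lattice sup linear_diff[OF lin] linear_neg[OF lin])
  obtain D where D: "D \<noteq> {}" "\<And>d. d \<in> D \<Longrightarrow> 0 \<le> d"
      "\<And>b. (\<And>d. d \<in> D \<Longrightarrow> b \<le> d) \<Longrightarrow> b \<le> 0"
      "\<And>d. d \<in> D \<Longrightarrow> \<exists>\<alpha>0\<in>\<Gamma>. \<forall>\<alpha>\<in>\<Gamma>. le \<alpha>0 \<alpha> \<longrightarrow> \<bar>x \<alpha> - l\<bar> \<le> d"
    using order_convergesE[OF x] by metis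
  show ?thesis
  proof (rule order_convergesI[OF \<Gamma>, where D = "j ` D"])
    show "j ` D \<noteq> {}" using D(1) by auto
  next
    fix b assume b: "\<And>d. d \<in> j ` D \<Longrightarrow> b \<le> d"
    show "b \<le> 0"
    proof (rule ccontr)
      assume "\<not> b \<le> 0"
      then have "0 < sup b 0" by (simp add: less_le_not_le)
      then obtain e where e: "0 < j e" "j e \<le> sup b 0" using dense by blast
      have "e \<le> 0"
      proof (rule D(3))
        fix d assume d: "d \<in> D"
        then have "0 \<le> j d" using D(2) le_iff[of 0 d] linear_0[OF lin] by simp
        then have "j e \<le> j d" using b d e(2) by (meson image_eqI le_sup_iff order_trans sup.boundedI)
        then show "e \<le> d" by (simp add: le_iff)
      qed
      then have "j e \<le> 0" using le_iff[of e 0] linear_0[OF lin] by simp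
      then show False using e(1) by simp
    qed
  next
    fix c assume "c \<in> j ` D"
    then show "\<exists>\<alpha>0\<in>\<Gamma>. \<forall>\<alpha>\<in>\<Gamma>. le \<alpha>0 \<alpha> \<longrightarrow> \<bar>j (x \<alpha>) - j l\<bar> \<le> c"
      using D(4) by (auto simp: abs le_iff)
  qed
qed

section \<open>Dominated series\<close>

definition series_remainder :: "(nat \<Rightarrow> 'a::dedekind_complete_riesz_space) \<Rightarrow> nat \<Rightarrow> 'a" where
  "series_remainder y N = (SUP n. \<Sum>k=1..n. y k) - (\<Sum>k=1..N. y k)"

lemma series_remainder_infimum:
  fixes y :: "nat \<Rightarrow> 'a::dedekind_complete_riesz_space"
  assumes "\<And>N. b \<le> series_remainder y N"
  shows "b \<le> 0"
proof -
  have "(\<Sum>k=1..N. y k) \<le> (SUP n. \<Sum>k=1..n. y k) - b" for N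
    using assms[of N] by (simp add: series_remainder_def le_diff_eq add.commute)
  then have "(SUP n. \<Sum>k=1..n. y k) \<le> (SUP n. \<Sum>k=1..n. y k) - b"
    by (intro cSUP_least) auto
  then show ?thesis by (simp add: le_diff_eq)
qed

lemma order_sums_if_remainder_bound:
  fixes y :: "nat \<Rightarrow> 'a::dedekind_complete_riesz_space"
  assumes y: "\<And>n. n \<ge> 1 \<Longrightarrow> 0 \<le> y n"
    and bound: "\<And>N. \<bar>(\<Sum>k=1..N. f k) - s\<bar> \<le> series_remainder y N"
  shows "order_sums f s"
  unfolding order_sums_def
proof (rule order_convergesI[where D = "range (series_remainder y)"])
  show "directed_set (UNIV :: nat set) (\<le>)" by (rule directed_set_nat)
  show "b \<le> 0" if "\<And>d. d \<in> range (series_remainder y) \<Longrightarrow> b \<le> d" for b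
    using that by (intro series_remainder_infimum) auto
next
  fix d assume "d \<in> range (series_remainder y)"
  then obtain M where d: "d = series_remainder y M" by auto
  have "\<bar>(\<Sum>k=1..N. f k) - s\<bar> \<le> d" if "M \<le> N" for N
  proof -
    have "(\<Sum>k=1..M. y k) \<le> (\<Sum>k=1..N. y k)"
      using that y by (intro sum_mono2) auto
    then have "series_remainder y N \<le> d" by (simp add: d series_remainder_def diff_left_mono)
    then show ?thesis by (rule order_trans[OF bound])
  qed
  then show "\<exists>M\<in>UNIV. \<forall>N\<in>UNIV. M \<le> N \<longrightarrow> \<bar>(\<Sum>k=1..N. f k) - s\<bar> \<le> d" by blast
qed simp

lemma order_sums_imp_suminf:
  assumes "order_sums f s"
  shows "order_suminf f = s"
  using assms unfolding order_suminf_def order_sums_def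
  by (blast intro: order_converges_unique[OF directed_set_nat])

text \<open>Adding \<open>y\<close> makes the terms of \<open>f\<close> positive, so that the partial sums \<open>P\<close> of \<open>f + y\<close>
  increase and have a supremum; the sum of \<open>f\<close> is that supremum minus the sum of \<open>y\<close>. As
  \<open>0 \<le> f + y \<le> 2 y\<close>, the remainder of \<open>f + y\<close> lies between zero and twice that of \<open>y\<close>, hence the
  remainder of \<open>f\<close> lies between plus and minus that of \<open>y\<close>.\<close>

lemma dominated_partial_sums:
  fixes f y :: "nat \<Rightarrow> 'a::dedekind_complete_riesz_space"
  assumes f: "\<And>n. n \<ge> 1 \<Longrightarrow> \<bar>f n\<bar> \<le> y n"
    and bdd: "bdd_above (range (\<lambda>n. \<Sum>k=1..n. y k))"
  shows "\<exists>s. \<forall>N. \<bar>(\<Sum>k=1..N. f k) - s\<bar> \<le> series_remainder y N"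
proof -
  define S where "S n = (\<Sum>k=1..n. y k)" for n
  define P where "P n = (\<Sum>k=1..n. f k + y k)" for n
  define Y where "Y = (SUP n. S n)"
  have S_le: "S n \<le> Y" for n
    unfolding Y_def using bdd by (intro cSUP_upper) (auto simp: S_def)
  have pos: "0 \<le> f k + y k" "f k + y k \<le> y k + y k" if "k \<ge> 1" for k
  proof -
    have "- f k \<le> y k" "f k \<le> y k"
      using order_trans[OF abs_ge_minus_self f[OF that]] order_trans[OF abs_ge_self f[OF that]] .
    then show "0 \<le> f k + y k" "f k + y k \<le> y k + y k"
      using add_left_mono[of "- f k" "y k" "f k"] add_right_mono[of "f k" "y k" "y k"] by simp_all
  qed
  have P_le: "P M \<le> P N + ((Y - S N) + (Y - S N))" for M N
  proof -
    \<comment> \<open>Beyond both indices the estimate is termwise; it descends to \<open>M\<close> by monotonicity.\<close>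
    define K where "K = max M N"
    have split: "sum h {1..K} = sum h {1..N} + sum h {N<..K}" for h :: "nat \<Rightarrow> 'a"
    proof -
      have "{1..K} = {1..N} \<union> {N<..K}" by (auto simp: K_def)
      then show ?thesis by (simp only:) (rule sum.union_disjoint, auto)
    qed
    have "P M \<le> P K"
      unfolding P_def using pos by (intro sum_mono2) (auto simp: K_def)
    also have "\<dots> = P N + (\<Sum>k\<in>{N<..K}. f k + y k)" unfolding P_def by (rule split)
    also have "\<dots> \<le> P N + (\<Sum>k\<in>{N<..K}. y k + y k)"
      using pos by (intro add_left_mono sum_mono) auto
    also have "\<dots> = P N + ((S K - S N) + (S K - S N))"
      using split[of y] by (simp add: S_def sum.distrib)
    also have "\<dots> \<le> P N + ((Y - S N) + (Y - S N))"
      using S_le by (intro add_left_mono add_mono diff_right_mono)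
    finally show ?thesis .
  qed
  define s where "s = (SUP n. P n) - Y"
  have "bdd_above (range P)"
    using P_le[of _ 0] by (auto simp: bdd_above_def)
  then have upper: "P N \<le> (SUP n. P n)" for N by (intro cSUP_upper) auto
  have lower: "(SUP n. P n) \<le> P N + ((Y - S N) + (Y - S N))" for N
    using P_le by (intro cSUP_least) auto
  have "\<bar>(\<Sum>k=1..N. f k) - s\<bar> \<le> series_remainder y N" for N
  proof (rule abs_leI)
    have eq: "(\<Sum>k=1..N. f k) = P N - S N" by (simp add: P_def S_def sum.distrib)
    have rem: "series_remainder y N = Y - S N" by (simp add: series_remainder_def Y_def S_def)
    show "(\<Sum>k=1..N. f k) - s \<le> series_remainder y N"
      unfolding eq rem s_def using upper[of N] by (simp add: algebra_simps)
    show "- ((\<Sum>k=1..N. f k) - s) \<le> series_remainder y N"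
      unfolding eq rem s_def using lower[of N] by (simp add: algebra_simps)
  qed
  then show ?thesis by blast
qed

lemma dominated_series:
  fixes f y :: "nat \<Rightarrow> 'a::dedekind_complete_riesz_space"
  assumes f: "\<And>n. n \<ge> 1 \<Longrightarrow> \<bar>f n\<bar> \<le> y n"
    and bdd: "bdd_above (range (\<lambda>n. \<Sum>k=1..n. y k))"
  shows "order_summable f"
    and "\<bar>(\<Sum>k=1..N. f k) - order_suminf f\<bar> \<le> series_remainder y N"
proof -
  obtain s where s: "\<And>N. \<bar>(\<Sum>k=1..N. f k) - s\<bar> \<le> series_remainder y N"
    using dominated_partial_sums[of f y, OF f bdd] by blast
  have "order_sums f s"
  proof (rule order_sums_if_remainder_bound[OF _ s])
    show "0 \<le> y n" if "n \<ge> 1" for n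
      using order_trans[OF abs_ge_zero f[OF that]] .
  qed
  then show "order_summable f"
    and "\<bar>(\<Sum>k=1..N. f k) - order_suminf f\<bar> \<le> series_remainder y N"
    using s[of N] by (auto simp: order_summable_def order_sums_imp_suminf)
qed

section \<open>Interchange of limit and sum\<close>

theorem theorem11:
  fixes j :: "'e::dedekind_complete_riesz_space \<Rightarrow> 'u::universally_complete_riesz_space"
    and \<Gamma> :: "'i set" and le :: "'i \<Rightarrow> 'i \<Rightarrow> bool"
    and x :: "'i \<Rightarrow> nat \<Rightarrow> 'e" and l :: "nat \<Rightarrow> 'e" and y :: "nat \<Rightarrow> 'u"
  assumes "universal_completion j"
    and "directed_set \<Gamma> le"
    and "\<And>n. n \<ge> 1 \<Longrightarrow> order_converges \<Gamma> le (\<lambda>\<alpha>. x \<alpha> n) (l n)"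
    and "\<And>n. n \<ge> 1 \<Longrightarrow> 0 \<le> y n"
    and "\<And>\<alpha> n. \<alpha> \<in> \<Gamma> \<Longrightarrow> n \<ge> 1 \<Longrightarrow> \<bar>j (x \<alpha> n)\<bar> \<le> y n"
    and "bdd_above (range (\<lambda>n. \<Sum>k=1..n. y k))"
  shows "(\<forall>\<alpha>\<in>\<Gamma>. order_summable (\<lambda>n. j (x \<alpha> n))) \<and>
    (\<forall>n\<ge>1. order_converges \<Gamma> le (\<lambda>\<alpha>. j (x \<alpha> n)) (j (l n))) \<and>
    order_summable (\<lambda>n. j (l n)) \<and>
    order_converges \<Gamma> le (\<lambda>\<alpha>. order_suminf (\<lambda>n. j (x \<alpha> n)))
      (order_suminf (\<lambda>n. j (l n)))"
proof -
  note \<Gamma> = assms(2)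
  have bound: "\<And>\<alpha> n. \<alpha> \<in> \<Gamma> \<Longrightarrow> n \<ge> 1 \<Longrightarrow> \<bar>j (x \<alpha> n)\<bar> \<le> y n"
    and bdd: "bdd_above (range (\<lambda>n. \<Sum>k=1..n. y k))"
    by fact+
  have lim: "order_converges \<Gamma> le (\<lambda>\<alpha>. j (x \<alpha> n)) (j (l n))" if "n \<ge> 1" for n
    using order_converges_embedding[OF assms(1) \<Gamma>] assms(3) that by blast
  have lim_bound: "\<bar>j (l n)\<bar> \<le> y n" if "n \<ge> 1" for n
    using order_converges_abs_le[OF \<Gamma> lim] bound that by blast
  have "order_converges \<Gamma> le (\<lambda>\<alpha>. order_suminf (\<lambda>n. j (x \<alpha> n))) (order_suminf (\<lambda>n. j (l n)))"
  proof (rule order_converges_uniform_limit[OF \<Gamma>])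
    show "order_converges \<Gamma> le (\<lambda>\<alpha>. \<Sum>k=1..N. j (x \<alpha> k)) (\<Sum>k=1..N. j (l k))" for N
      using lim by (intro order_converges_sum[OF \<Gamma>]) auto
    show "b \<le> 0" if "\<And>N. b \<le> series_remainder y N" for b
      using that by (rule series_remainder_infimum)
    next
    show "\<bar>(\<Sum>k=1..N. j (x \<alpha> k)) - order_suminf (\<lambda>n. j (x \<alpha> n))\<bar> \<le> series_remainder y N"
      if "\<alpha> \<in> \<Gamma>" for N \<alpha>
      by (rule dominated_series(2)[OF _ bdd]) (rule bound[OF that])
    show "\<bar>(\<Sum>k=1..N. j (l k)) - order_suminf (\<lambda>n. j (l n))\<bar> \<le> series_remainder y N" for N
      by (rule dominated_series(2)[OF _ bdd]) (rule lim_bound)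
  qed
  moreover have "order_summable (\<lambda>n. j (x \<alpha> n))" if "\<alpha> \<in> \<Gamma>" for \<alpha>
    by (rule dominated_series(1)[OF _ bdd]) (rule bound[OF that])
  moreover have "order_summable (\<lambda>n. j (l n))"
    by (rule dominated_series(1)[OF _ bdd]) (rule lim_bound)
  ultimately show ?thesis using lim by blast
qed

end
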